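(* Let $H$ be a separable infinite-dimensional Hilbert space and let $(f_n)_{n=1}^\infty$ be a Parseval frame in $H$ such that $e((f_n)_{n=1}^\infty)<\infty$. Then for each $\epsilon>0$ there exists $n_0\in\mathbb N$ such that $$\sum_{n=1}^{n_0}|\langle x,f_n\rangle|^2+\left\|\sum_{n=n_0+1}^{\infty}\langle x,f_n\rangle f_n\right\|^2>(1-\epsilon)\|x\|^2,\quad\forall x\in H\setminus\{0\},$$ and $$\sum_{n=n_0+1}^{\infty}|\langle x,f_n\rangle|^2+\left\|\sum_{n=1}^{n_0}\langle x,f_n\rangle f_n\right\|^2>(1-\epsilon)\|x\|^2,\quad\forall x\in H\setminus\{0\}.$$
   Context: $\mathbb N=\{1,2,3,\ldots\}$. A sequence $(f_n)_{n=1}^\infty$ in $H$ is a Parseval frame if $\sum_{n=1}^\infty|\langle x,f_n\rangle|^2=\|x\|^2$ for all $x\in H$. The excess $e((f_n)_{n=1}^\infty)$ of a frame is the greatest integer $k$ such that some $k$ elements can be deleted from the frame and still leave a complete set (a set whose closed linear span is $H$), or $+\infty$ if there is no upper bound to the number of elements that can be removed. *)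

theory Defs
  imports "HOL-Analysis.Analysis"
begin

text \<open>
  The scalars of a Hilbert space, real or complex, treated uniformly. By the Gelfand--Mazur
  theorem a field of class \<open>real_normed_field\<close> (multiplicative norm) is isomorphic to the reals
  or to the complex numbers; the last axiom then determines the conjugation.
\<close>

class real_or_complex = real_normed_field +
  fixes conjugate :: "'a \<Rightarrow> 'a"
  assumes conjugate_add: "conjugate (a + b) = conjugate a + conjugate b"
    and conjugate_mult: "conjugate (a * b) = conjugate a * conjugate b"
    and conjugate_conjugate: "conjugate (conjugate a) = a"
    and mult_conjugate: "a * conjugate a = (norm a)\<^sup>2 *\<^sub>R 1"

instantiation real :: real_or_complex
begin
definition conjugate_real :: "real \<Rightarrow> real" where "conjugate_real a = a"
instance
  by standard (simp_all add: conjugate_real_def power2_eq_square)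
end

instantiation complex :: real_or_complex
begin
definition conjugate_complex :: "complex \<Rightarrow> complex" where "conjugate_complex a = cnj a"
instance
  by standard (simp_all add: conjugate_complex_def scaleR_conv_of_real flip: complex_norm_square)
end

text \<open>
  A Hilbert space over \<open>'k\<close>. Completeness, and the topology used for closures and
  infinite series, come from the class \<open>banach\<close>, whose norm is required to be the one
  induced by the inner product. The inner product is linear in its first argument.
\<close>

locale hilbert_space = vector_space smul
  for smul :: "'k::real_or_complex \<Rightarrow> 'a::banach \<Rightarrow> 'a" +
  fixes ip :: "'a \<Rightarrow> 'a \<Rightarrow> 'k"
  assumes scale_of_real: "smul (of_real r) x = r *\<^sub>R x"
    and ip_add_left: "ip (x + y) z = ip x z + ip y z"
    and ip_scale_left: "ip (smul a x) y = a * ip x y"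
    and ip_commute: "ip y x = conjugate (ip x y)"
    and ip_self: "ip x x = of_real ((norm x)\<^sup>2)"

lemma hilbert_space_real:
  "hilbert_space scaleR (inner :: 'a::{real_inner, banach} \<Rightarrow> 'a \<Rightarrow> real)"
  by unfold_locales
    (simp_all add: conjugate_real_def inner_add_left inner_add_right inner_commute power2_norm_eq_inner
      scaleR_add_right scaleR_add_left)

lemma hilbert_space_complex: "hilbert_space (*) (\<lambda>x y :: complex. x * cnj y)"
  by unfold_locales
    (simp_all add: conjugate_complex_def algebra_simps scaleR_conv_of_real
      flip: complex_norm_square)

definition separable :: "'a::topological_space itself \<Rightarrow> bool" where
  "separable _ \<longleftrightarrow> (\<exists>D :: 'a set. countable D \<and> closure D = UNIV)"

definition infinite_dimensional :: "('k::field \<Rightarrow> 'a::ab_group_add \<Rightarrow> 'a) \<Rightarrow> bool" where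
  "infinite_dimensional smul \<longleftrightarrow> \<not> (\<exists>B. finite B \<and> module.span smul B = UNIV)"

definition complete_set ::
    "('k::field \<Rightarrow> 'a::{ab_group_add, topological_space} \<Rightarrow> 'a) \<Rightarrow> 'a set \<Rightarrow> bool" where
  "complete_set smul S \<longleftrightarrow> closure (module.span smul S) = UNIV"

text \<open>
  Sequences \<open>(f\<^sub>n)\<close> are indexed by \<open>n \<ge> 1\<close>; the value \<open>f 0\<close> is never used.
\<close>

definition parseval_frame ::
    "('a \<Rightarrow> 'a \<Rightarrow> 'k::real_normed_field) \<Rightarrow> (nat \<Rightarrow> 'a::real_normed_vector) \<Rightarrow> bool" where
  "parseval_frame ip f \<longleftrightarrow> (\<forall>x. (\<lambda>n. (norm (ip x (f (Suc n))))\<^sup>2) sums (norm x)\<^sup>2)"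

text \<open>
  Elements are deleted from the sequence by index, so a vector occurring with several indices
  counts with its multiplicity. On \<open>enat\<close>, the supremum of a nonempty set is its
  maximum if the set is bounded and \<open>\<infinity>\<close> otherwise.
\<close>

definition excess ::
    "('k::field \<Rightarrow> 'a::{ab_group_add, topological_space} \<Rightarrow> 'a) \<Rightarrow> (nat \<Rightarrow> 'a) \<Rightarrow> enat" where
  "excess smul f =
     Sup {enat (card J) | J. finite J \<and> J \<subseteq> {1..} \<and> complete_set smul (f ` ({1..} - J))}"

end

theory Submission imports Defs begin

text \<open>
  Write \<open>S\<^sub>K x = (\<Sum>k\<in>K. \<langle>x, f\<^sub>k\<rangle> f\<^sub>k)\<close> for a finite set \<open>K\<close> of indices and \<open>S = S\<^sub>K\<close> with
  \<open>K = {1..n\<^sub>0}\<close>. The frame operator of a Parseval frame is the identity, so the tail of the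
  reconstruction series is \<open>x - S x\<close>, and both left-hand sides are equal to
  \<open>\<parallel>x\<parallel>\<^sup>2 - (\<langle>S x, x\<rangle> - \<parallel>S x\<parallel>\<^sup>2)\<close>. The claim is therefore that the single defect
  \<open>\<langle>S x, x\<rangle> - \<parallel>S x\<parallel>\<^sup>2 = \<langle>x - S x, S x\<rangle>\<close>, which measures how far \<open>S\<close> is from being a projection,
  is small compared with \<open>\<parallel>x\<parallel>\<^sup>2\<close>.

  The defect only involves inner products \<open>\<langle>f\<^sub>k, f\<^sub>l\<rangle>\<close> with \<open>l \<le> n\<^sub>0 < k\<close>. The Parseval identity
  at \<open>f\<^sub>k\<close>, whose own contribution is \<open>\<parallel>f\<^sub>k\<parallel>\<^sup>4\<close>, gives
  \<open>(\<Sum>l\<noteq>k. |\<langle>f\<^sub>k, f\<^sub>l\<rangle>|\<^sup>2) = \<parallel>f\<^sub>k\<parallel>\<^sup>2 - \<parallel>f\<^sub>k\<parallel>\<^sup>4 \<le> 1 - \<parallel>f\<^sub>k\<parallel>\<^sup>2\<close>. By two applications of the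
  Cauchy--Schwarz inequality, the defect is at most \<open>\<parallel>x\<parallel>\<^sup>2\<close> times the square root of
  \<open>\<Sum>k>n\<^sub>0. 1 - \<parallel>f\<^sub>k\<parallel>\<^sup>2\<close> (\<open>frame_sum_defect_le\<close>).

  It remains to see that finite excess makes \<open>\<Sum>k. 1 - \<parallel>f\<^sub>k\<parallel>\<^sup>2\<close> converge
  (\<open>summable_one_minus_norm_square\<close>). The elements with indices in a finite set \<open>K\<close> can be removed
  exactly if \<open>I - S\<^sub>K\<close>, the frame operator of the rest, is injective; since \<open>S\<^sub>K\<close> has range in the
  span of finitely many vectors, injectivity also makes \<open>I - S\<^sub>K\<close> surjective on that span.
  Let \<open>J\<close> be a removable set of largest size, and choose \<open>h\<^sub>j\<close> with
  \<open>(I - S\<^sub>J) h\<^sub>j = f\<^sub>j\<close>. For \<open>m \<notin> J\<close> the set \<open>J \<union> {m}\<close> is not removable, so there is a nonzero \<open>u\<close>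
  with \<open>(I - S\<^sub>J) u = \<langle>u, f\<^sub>m\<rangle> f\<^sub>m\<close>, and pairing this equation with \<open>f\<^sub>m\<close> and with the \<open>h\<^sub>j\<close> gives
  \<open>1 - \<parallel>f\<^sub>m\<parallel>\<^sup>2 = (\<Sum>j\<in>J. \<langle>f\<^sub>m, h\<^sub>j\<rangle> \<langle>f\<^sub>j, f\<^sub>m\<rangle>)\<close>. The right-hand side is summable over \<open>m\<close>, because
  Parseval's identity makes \<open>\<langle>f\<^sub>m, h\<^sub>j\<rangle>\<close> and \<open>\<langle>f\<^sub>j, f\<^sub>m\<rangle>\<close> square-summable.
\<close>

section \<open>Endomorphisms of finitely generated spans\<close>

text \<open>
  The surrounding space may be infinite-dimensional, so the usual rank argument is carried out
  inside the span: the image of a basis is independent and has as many elements as the basis, so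
  no further element of the span can be added to it without losing independence.
\<close>

lemma (in vector_space) injective_on_span_imp_surjective_on_span:
  assumes "finite T" and lin: "Vector_Spaces.linear scale scale L"
    and into: "L ` span T \<subseteq> span T"
    and inj: "\<And>v. v \<in> span T \<Longrightarrow> L v = 0 \<Longrightarrow> v = 0"
  shows "span T \<subseteq> L ` span T"
proof -
  interpret L: Vector_Spaces.linear scale scale L by (rule lin)
  obtain B where B: "B \<subseteq> T" "independent B" "T \<subseteq> span B"
    using maximal_independent_subset by blast
  have fin: "finite B" using B(1) assms(1) by (rule finite_subset)
  have span: "span B = span T"
    using B by (metis span_mono span_span subset_antisym)
  have inj_on: "inj_on L (span B)"
    using inj span by (simp add: L.inj_on_iff_eq_0)
  have "independent (L ` B)"
    using B(2) inj_on by (rule L.independent_injective_image)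
  moreover have "L ` B \<subseteq> span B"
    using into span span_superset by blast
  moreover have "card (L ` B) = card B"
    using inj_on span_superset by (metis card_image inj_on_subset)
  ultimately have "B \<subseteq> span (L ` B)"
    using independent_insertI[of _ "L ` B"] independent_span_bound[OF fin, of "insert _ (L ` B)"]
      fin span_superset[of B] span_superset[of "L ` B"]
    by (smt (verit) card_insert_disjoint finite_imageI insert_subset not_less_eq_eq order_refl subset_iff)
  then have "span B \<subseteq> span (L ` B)"
    by (rule span_minimal) (rule subspace_span)
  then show ?thesis
    using span by (simp add: L.span_image)
qed

section \<open>Inner products over the real or complex scalars\<close>
lemma conjugate_0 [simp]: "conjugate (0::'k::real_or_complex) = 0"
  using conjugate_add[of "0::'k" 0] by simp

lemma norm_conjugate [simp]: "norm (conjugate a) = norm (a::'k::real_or_complex)"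
proof (cases "a = 0")
  case False
  have "norm a * norm (conjugate a) = norm a * norm a"
    using arg_cong[OF mult_conjugate[of a], of norm] by (simp add: norm_mult power2_eq_square)
  then show ?thesis using False by simp
qed simp

lemma mult_conjugate_eq_of_real: "a * conjugate a = of_real ((norm (a::'k::real_or_complex))\<^sup>2)"
  by (simp add: mult_conjugate of_real_def)

context hilbert_space
begin

lemma ip_zero_left [simp]: "ip 0 y = 0"
  using ip_add_left[of 0 0 y] by simp

lemma ip_zero_right [simp]: "ip x 0 = 0"
  using ip_commute[of x 0] by simp

lemma ip_diff_left: "ip (x - y) z = ip x z - ip y z"
  using ip_add_left[of "x - y" y z] by (simp add: algebra_simps)

lemma ip_add_right: "ip x (y + z) = ip x y + ip x z"
  by (metis conjugate_add ip_add_left ip_commute)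

lemma ip_diff_right: "ip x (y - z) = ip x y - ip x z"
  using ip_add_right[of x "y - z" z] by (simp add: algebra_simps)

lemma ip_scale_right: "ip x (smul a y) = conjugate a * ip x y"
  by (metis conjugate_mult ip_scale_left ip_commute)

lemma ip_sum_left: "ip (sum g A) y = (\<Sum>i\<in>A. ip (g i) y)"
  by (induction A rule: infinite_finite_induct) (simp_all add: ip_add_left)

lemma ip_sum_right: "ip x (sum g A) = (\<Sum>i\<in>A. ip x (g i))"
  by (induction A rule: infinite_finite_induct) (simp_all add: ip_add_right)

lemma norm_ip_commute: "norm (ip x y) = norm (ip y x)"
  by (metis ip_commute norm_conjugate)

lemma ip_mult_ip_commute: "ip x y * ip y x = of_real ((norm (ip x y))\<^sup>2)"
  by (metis ip_commute mult_conjugate_eq_of_real)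

text \<open>
  The Cauchy--Schwarz inequality: subtracting from \<open>x\<close> its component along \<open>y\<close> leaves a vector
  whose squared norm \<open>\<parallel>x\<parallel>\<^sup>2 - |\<langle>x, y\<rangle>|\<^sup>2 / \<parallel>y\<parallel>\<^sup>2\<close> is nonnegative.
\<close>
lemma norm_ip_le: "norm (ip x y) \<le> norm x * norm y"
proof (cases "y = 0")
  case False
  define c :: 'k where "c = ip x y / of_real ((norm y)\<^sup>2)"
  have y: "(of_real ((norm y)\<^sup>2) :: 'k) \<noteq> 0"
    using False by simp
  have *: "ip (x - smul c y) y = 0"
    using y by (simp add: ip_diff_left ip_scale_left ip_self c_def)
  have "ip (x - smul c y) (x - smul c y) = ip (x - smul c y) x"
    using * by (simp add: ip_diff_right ip_scale_right)
  also have "\<dots> = of_real ((norm x)\<^sup>2) - of_real ((norm (ip x y))\<^sup>2) / of_real ((norm y)\<^sup>2)"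
    using ip_mult_ip_commute[of x y] by (simp add: ip_diff_left ip_scale_left ip_self c_def)
  finally have "(of_real ((norm (x - smul c y))\<^sup>2) :: 'k)
      = of_real ((norm x)\<^sup>2 - (norm (ip x y))\<^sup>2 / (norm y)\<^sup>2)"
    by (simp add: ip_self)
  then have "(norm x)\<^sup>2 - (norm (ip x y))\<^sup>2 / (norm y)\<^sup>2 \<ge> 0"
    by (metis of_real_eq_iff zero_le_power2)
  then have "(norm (ip x y))\<^sup>2 \<le> (norm x * norm y)\<^sup>2"
    using False by (simp add: field_simps power_mult_distrib)
  then show ?thesis
    by (rule power2_le_imp_le) simp
qed simp

lemma tendsto_ip_left:
  assumes "(g \<longlongrightarrow> x) F"
  shows "((\<lambda>i. ip (g i) y) \<longlongrightarrow> ip x y) F"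
proof (rule Lim_null_comparison[THEN Lim_null[THEN iffD2]])
  have "norm (ip (g i) y - ip x y) \<le> norm (g i - x) * norm y" for i
    using norm_ip_le[of "g i - x" y] by (simp add: ip_diff_left)
  then show "\<forall>\<^sub>F i in F. norm (ip (g i) y - ip x y) \<le> norm (g i - x) * norm y"
    by simp
  show "((\<lambda>i. norm (g i - x) * norm y) \<longlongrightarrow> 0) F"
    using assms by (metis Lim_null tendsto_mult_left_zero tendsto_norm_zero)
qed

lemma orthogonal_to_complete_set_imp_0:
  assumes S: "complete_set smul S" and orth: "\<And>y. y \<in> S \<Longrightarrow> ip x y = 0"
  shows "x = 0"
proof -
  have span: "ip y x = 0" if "y \<in> span S" for y
    using that
  proof (induction rule: span_induct_alt)
    case (step c y z)
    then show ?case using orth[of y] ip_commute[of y x]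
      by (simp add: ip_add_left ip_scale_left)
  qed simp
  have "x \<in> closure (span S)"
    using S by (simp add: complete_set_def)
  then obtain g where g: "\<And>n. g n \<in> span S" "g \<longlonglongrightarrow> x"
    by (auto simp: closure_sequential)
  have "(\<lambda>n. ip (g n) x) \<longlonglongrightarrow> ip x x"
    using g(2) by (rule tendsto_ip_left)
  then have "ip x x = 0"
    using span g(1) by (simp add: LIMSEQ_const_iff)
  then show ?thesis by (simp add: ip_self)
qed

end


section \<open>Partial frame operators of a Parseval frame\<close>
lemma sum_mult_le_sqrt_sum_squares:
  fixes a b :: "'i \<Rightarrow> real"
  shows "(\<Sum>i\<in>A. \<bar>a i\<bar> * \<bar>b i\<bar>) \<le> sqrt (\<Sum>i\<in>A. (a i)\<^sup>2) * sqrt (\<Sum>i\<in>A. (b i)\<^sup>2)"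
  using L2_set_mult_ineq[of a b A] by (simp add: L2_set_def)

lemma eventually_subset_atLeastAtMost:
  fixes K :: "nat set"
  assumes "finite K" "K \<subseteq> {m..}"
  shows "\<forall>\<^sub>F N in sequentially. K \<subseteq> {m..N}"
  using eventually_ge_at_top[of "Max K"]
proof eventually_elim
  case (elim N)
  show "K \<subseteq> {m..N}"
  proof
    fix k assume "k \<in> K"
    then show "k \<in> {m..N}"
      using Max_ge[OF assms(1), of k] elim assms(2) by auto
  qed
qed

locale parseval_hilbert_space = hilbert_space smul ip
  for smul :: "'k::real_or_complex \<Rightarrow> 'a::banach \<Rightarrow> 'a" and ip +
  fixes f :: "nat \<Rightarrow> 'a"
  assumes parseval: "parseval_frame ip f"
begin

text \<open>
  This is the frame operator of the finite subfamily \<open>(f\<^sub>k)\<close>, \<open>k \<in> K\<close>. The vectors with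
  \<open>frame_sum K u = u\<close> form the kernel of the frame operator of the remaining elements.
\<close>
definition frame_sum :: "nat set \<Rightarrow> 'a \<Rightarrow> 'a" where
  "frame_sum K x = (\<Sum>k\<in>K. smul (ip x (f k)) (f k))"

lemma ip_frame_sum_left: "ip (frame_sum K x) y = (\<Sum>k\<in>K. ip x (f k) * ip (f k) y)"
  by (simp add: frame_sum_def ip_sum_left ip_scale_left)

lemma frame_sum_self_adjoint: "ip (frame_sum K x) y = ip x (frame_sum K y)"
proof -
  have "ip x (frame_sum K y) = (\<Sum>k\<in>K. conjugate (ip y (f k)) * ip x (f k))"
    by (simp add: frame_sum_def ip_sum_right ip_scale_right)
  then show ?thesis
    by (simp add: ip_frame_sum_left mult.commute flip: ip_commute)
qed

lemma ip_frame_sum_self: "ip (frame_sum K x) x = of_real (\<Sum>k\<in>K. (norm (ip x (f k)))\<^sup>2)"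
  by (simp add: ip_frame_sum_left ip_mult_ip_commute)

lemma linear_frame_sum: "Vector_Spaces.linear smul smul (frame_sum K)"
  by unfold_locales
    (simp_all add: frame_sum_def ip_add_left ip_scale_left scale_left_distrib scale_sum_right
      sum.distrib)

lemma frame_sum_in_span: "frame_sum K x \<in> span (f ` K)"
  unfolding frame_sum_def by (intro span_sum span_scale span_base) auto

lemma parseval_partial_sums:
  "(\<lambda>N. \<Sum>k=1..N. (norm (ip x (f k)))\<^sup>2) \<longlonglongrightarrow> (norm x)\<^sup>2"
  using parseval by (simp add: parseval_frame_def sums_def sum.atLeast1_atMost_eq)

lemma bessel:
  assumes "finite K" "K \<subseteq> {1..}"
  shows "(\<Sum>k\<in>K. (norm (ip x (f k)))\<^sup>2) \<le> (norm x)\<^sup>2"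
proof -
  have "\<forall>\<^sub>F N in sequentially.
      (\<Sum>k\<in>K. (norm (ip x (f k)))\<^sup>2) \<le> (\<Sum>k=1..N. (norm (ip x (f k)))\<^sup>2)"
    using eventually_subset_atLeastAtMost[OF assms] by eventually_elim (intro sum_mono2; auto)
  then show ?thesis
    by (rule tendsto_lowerbound[OF parseval_partial_sums]) simp
qed

text \<open>
  The synthesis operator is a contraction, being the adjoint of the analysis operator, which is an
  isometry. In terms of \<open>y = S\<^sub>K x\<close>: expand \<open>\<parallel>y\<parallel>\<^sup>2 = \<langle>S\<^sub>K x, y\<rangle>\<close>, apply the Cauchy--Schwarz
  inequality to the sum, and bound the coefficients of \<open>y\<close> by Bessel's inequality.
\<close>
lemma norm_frame_sum_le:
  assumes "finite K" "K \<subseteq> {1..}"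
  shows "(norm (frame_sum K x))\<^sup>2 \<le> (\<Sum>k\<in>K. (norm (ip x (f k)))\<^sup>2)"
proof -
  define y where "y = frame_sum K x"
  define A where "A = sqrt (\<Sum>k\<in>K. (norm (ip x (f k)))\<^sup>2)"
  have A: "A \<ge> 0" by (simp add: A_def sum_nonneg)
  have "(norm y)\<^sup>2 = norm (ip y y)"
    by (simp add: ip_self norm_power)
  also have "\<dots> \<le> (\<Sum>k\<in>K. \<bar>norm (ip x (f k))\<bar> * \<bar>norm (ip y (f k))\<bar>)"
    using norm_sum[of "\<lambda>k. ip x (f k) * ip (f k) y" K]
    by (simp add: y_def ip_frame_sum_left norm_mult norm_ip_commute[of "f _"])
  also have "\<dots> \<le> A * sqrt (\<Sum>k\<in>K. (norm (ip y (f k)))\<^sup>2)"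
    unfolding A_def by (rule sum_mult_le_sqrt_sum_squares)
  also have "\<dots> \<le> A * norm y"
    using bessel[OF assms, of y] A by (intro mult_left_mono) (auto intro: real_le_lsqrt)
  finally have "norm y \<le> A"
    using A by (cases "norm y = 0") (auto simp: power2_eq_square)
  then have "(norm y)\<^sup>2 \<le> A\<^sup>2"
    by (intro power_mono) auto
  then show ?thesis
    by (simp add: y_def A_def sum_nonneg)
qed

text \<open>
  With \<open>\<langle>S\<^sub>K x, x\<rangle> = (\<Sum>k\<in>K. |\<langle>x, f\<^sub>k\<rangle>|\<^sup>2)\<close>, the identity shows why the two expressions in the theorem
  agree: adding \<open>\<langle>S\<^sub>K x, x\<rangle>\<close> to it leaves \<open>\<parallel>x\<parallel>\<^sup>2 - \<langle>S\<^sub>K x, x\<rangle> + \<parallel>S\<^sub>K x\<parallel>\<^sup>2\<close>.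
\<close>
lemma norm_diff_frame_sum:
  "(norm (x - frame_sum K x))\<^sup>2
    = (norm x)\<^sup>2 - 2 * (\<Sum>k\<in>K. (norm (ip x (f k)))\<^sup>2) + (norm (frame_sum K x))\<^sup>2"
proof -
  let ?y = "frame_sum K x"
  have "ip (x - ?y) (x - ?y) = ip x x - ip ?y x - ip ?y x + ip ?y ?y"
    by (simp add: ip_diff_left ip_diff_right frame_sum_self_adjoint[of K x x, symmetric])
  then have "(of_real ((norm (x - ?y))\<^sup>2) :: 'k)
      = of_real ((norm x)\<^sup>2 - 2 * (\<Sum>k\<in>K. (norm (ip x (f k)))\<^sup>2) + (norm ?y)\<^sup>2)"
    by (simp add: ip_self ip_frame_sum_self)
  then show ?thesis by (simp only: of_real_eq_iff)
qed

text \<open>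
  The reconstruction formula. By the two preceding lemmas the squared distance from \<open>x\<close> to the
  partial sum is at most the tail of the Parseval series of \<open>x\<close>.
\<close>
lemma frame_sum_tendsto: "(\<lambda>N. frame_sum {1..N} x) \<longlonglongrightarrow> x"
proof -
  have "(\<lambda>N. (norm (x - frame_sum {1..N} x))\<^sup>2) \<longlonglongrightarrow> 0"
  proof (rule Lim_null_comparison)
    have "(norm (x - frame_sum {1..N} x))\<^sup>2 \<le> (norm x)\<^sup>2 - (\<Sum>k=1..N. (norm (ip x (f k)))\<^sup>2)" for N
      using norm_frame_sum_le[of "{1..N}" x] by (simp add: norm_diff_frame_sum)
    then show "\<forall>\<^sub>F N in sequentially. norm ((norm (x - frame_sum {1..N} x))\<^sup>2)
        \<le> (norm x)\<^sup>2 - (\<Sum>k=1..N. (norm (ip x (f k)))\<^sup>2)"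
      by simp
    show "(\<lambda>N. (norm x)\<^sup>2 - (\<Sum>k=1..N. (norm (ip x (f k)))\<^sup>2)) \<longlonglongrightarrow> 0"
      using tendsto_diff[OF tendsto_const parseval_partial_sums, of "(norm x)\<^sup>2" x] by simp
  qed
  then have "(\<lambda>N. sqrt ((norm (x - frame_sum {1..N} x))\<^sup>2)) \<longlonglongrightarrow> sqrt 0"
    by (rule tendsto_real_sqrt)
  then have "(\<lambda>N. norm (frame_sum {1..N} x - x)) \<longlonglongrightarrow> 0"
    by (simp add: norm_minus_commute)
  then show ?thesis
    unfolding tendsto_norm_zero_iff by (rule LIM_zero_cancel)
qed

lemma frame_sum_Diff_tendsto:
  assumes "finite K" "K \<subseteq> {1..}"
  shows "(\<lambda>N. frame_sum ({1..N} - K) x) \<longlonglongrightarrow> x - frame_sum K x"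
proof (rule Lim_transform_eventually)
  show "(\<lambda>N. frame_sum {1..N} x - frame_sum K x) \<longlonglongrightarrow> x - frame_sum K x"
    by (intro tendsto_intros frame_sum_tendsto)
  show "\<forall>\<^sub>F N in sequentially.
      frame_sum {1..N} x - frame_sum K x = frame_sum ({1..N} - K) x"
    using eventually_subset_atLeastAtMost[OF assms]
    by eventually_elim (simp add: frame_sum_def sum_diff)
qed

section \<open>Removing finitely many elements\<close>
lemma residual_surjective_on_span:
  assumes K: "finite K" and inj: "\<And>u. frame_sum K u = u \<Longrightarrow> u = 0"
    and v: "v \<in> span (f ` K)"
  obtains h where "h - frame_sum K h = v"
proof -
  interpret S: Vector_Spaces.linear smul smul "frame_sum K"
    by (rule linear_frame_sum)
  let ?L = "\<lambda>x. x - frame_sum K x"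
  have "Vector_Spaces.linear smul smul ?L"
    by unfold_locales (simp_all add: S.add S.scale scale_right_diff_distrib)
  then have "span (f ` K) \<subseteq> ?L ` span (f ` K)"
  proof (rule injective_on_span_imp_surjective_on_span[rotated])
    show "?L ` span (f ` K) \<subseteq> span (f ` K)"
      using frame_sum_in_span by (auto intro: span_diff)
  qed (use K inj in auto)
  then show ?thesis using v that by auto
qed

text \<open>
  Put \<open>T = I - S\<^sub>K\<close>. As \<open>T\<close> reaches every vector in the span of the removed elements, there is an
  \<open>h\<close> with \<open>T h = S\<^sub>K x\<close>, and then \<open>x = T x + S\<^sub>K x = T (x + h)\<close> is a limit of combinations of the
  remaining elements. In particular, if they are not complete, then a nonzero vector orthogonal to
  all of them exists, a fact that is obtained here without orthogonal projections.
\<close>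
lemma complete_set_if_residual_injective:
  assumes K: "finite K" "K \<subseteq> {1..}" and inj: "\<And>u. frame_sum K u = u \<Longrightarrow> u = 0"
  shows "complete_set smul (f ` ({1..} - K))"
proof -
  have "x \<in> closure (span (f ` ({1..} - K)))" for x
  proof -
    obtain h where h: "h - frame_sum K h = frame_sum K x"
      using residual_surjective_on_span[OF K(1) inj frame_sum_in_span] by blast
    interpret S: Vector_Spaces.linear smul smul "frame_sum K"
      by (rule linear_frame_sum)
    have "(x + h) - frame_sum K (x + h) = x"
      using h by (simp add: S.add algebra_simps)
    then have "(\<lambda>N. frame_sum ({1..N} - K) (x + h)) \<longlonglongrightarrow> x"
      using frame_sum_Diff_tendsto[OF K, of "x + h"] by simp
    moreover have "frame_sum ({1..N} - K) (x + h) \<in> span (f ` ({1..} - K))" for N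
      using frame_sum_in_span by (rule subsetD[OF span_mono, rotated]) auto
    ultimately show ?thesis
      unfolding closure_sequential by (intro exI conjI allI)
  qed
  then show ?thesis by (auto simp: complete_set_def)
qed

text \<open>
  If \<open>S\<^sub>K u = u\<close>, then the coefficients with indices in \<open>K\<close> already exhaust \<open>\<parallel>u\<parallel>\<^sup>2\<close> in the
  Parseval identity, so that all others vanish.
\<close>
lemma fixed_imp_orthogonal:
  assumes K: "finite K" "K \<subseteq> {1..}" and u: "frame_sum K u = u" and n: "n \<ge> 1" "n \<notin> K"
  shows "ip u (f n) = 0"
proof -
  have "(of_real (\<Sum>k\<in>K. (norm (ip u (f k)))\<^sup>2) :: 'k) = of_real ((norm u)\<^sup>2)"
    using ip_frame_sum_self[of K u] u by (simp only: ip_self)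
  then have "(\<Sum>k\<in>K. (norm (ip u (f k)))\<^sup>2) = (norm u)\<^sup>2"
    by (simp only: of_real_eq_iff)
  then have "(norm (ip u (f n)))\<^sup>2 \<le> 0"
    using bessel[of "insert n K" u] K n by simp
  then show ?thesis by simp
qed

lemma residual_injective_if_complete_set:
  assumes K: "finite K" "K \<subseteq> {1..}" and compl: "complete_set smul (f ` ({1..} - K))"
    and u: "frame_sum K u = u"
  shows "u = 0"
  using compl
proof (rule orthogonal_to_complete_set_imp_0)
  fix y assume "y \<in> f ` ({1..} - K)"
  then show "ip u y = 0"
    using fixed_imp_orthogonal[OF K u] by auto
qed

text \<open>
  A finite supremum in \<open>enat\<close> of a nonempty set is attained. The set of sizes is nonempty because
  the empty set is removable: the frame itself is complete.
\<close>
lemma maximal_removable_set: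
  assumes "excess smul f < \<infinity>"
  obtains J where "finite J" "J \<subseteq> {1..}" "complete_set smul (f ` ({1..} - J))"
    "\<And>m. m \<ge> 1 \<Longrightarrow> m \<notin> J \<Longrightarrow> \<not> complete_set smul (f ` ({1..} - insert m J))"
proof -
  define A where "A = {enat (card J) | J.
    finite J \<and> J \<subseteq> {1..} \<and> complete_set smul (f ` ({1..} - J))}"
  have "complete_set smul (f ` ({1..} - {}))"
    by (rule complete_set_if_residual_injective) (auto simp: frame_sum_def)
  then have ne: "A \<noteq> {}"
    unfolding A_def by blast
  have "Sup A \<noteq> \<infinity>"
    using assms by (simp add: excess_def A_def)
  then have fin: "finite A" and Sup: "Sup A = Max A"
    using ne by (auto simp: Sup_enat_def split: if_splits)
  have "Max A \<in> A"
    using fin ne by (rule Max_in)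
  then obtain J where J: "finite J" "J \<subseteq> {1..}" "complete_set smul (f ` ({1..} - J))"
      "Max A = enat (card J)"
    unfolding A_def by auto
  have "\<not> complete_set smul (f ` ({1..} - insert m J))" if m: "m \<ge> 1" "m \<notin> J" for m
  proof
    assume "complete_set smul (f ` ({1..} - insert m J))"
    then have "enat (card (insert m J)) \<in> A"
      unfolding A_def using J m by blast
    then have "enat (card (insert m J)) \<le> enat (card J)"
      using fin J(4) Max_ge by metis
    then show False using J(1) m by simp
  qed
  with J show ?thesis using that by blast
qed

section \<open>Finite excess and the norms of the frame elements\<close>

text \<open>
  With \<open>t = \<parallel>f\<^sub>n\<parallel>\<^sup>2\<close>, the term of index \<open>n\<close> in Bessel's inequality at \<open>f\<^sub>n\<close> is \<open>t\<^sup>2\<close>, which leaves at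
  most \<open>t - t\<^sup>2 \<le> 1 - t\<close> for the other terms.
\<close>
lemma sum_norm_ip_frame_le:
  assumes K: "finite K" "K \<subseteq> {1..}" and n: "n \<ge> 1" "n \<notin> K"
  shows "(\<Sum>k\<in>K. (norm (ip (f n) (f k)))\<^sup>2) \<le> 1 - (norm (f n))\<^sup>2"
proof -
  define t where "t = (norm (f n))\<^sup>2"
  have "t\<^sup>2 + (\<Sum>k\<in>K. (norm (ip (f n) (f k)))\<^sup>2) \<le> t"
    using bessel[of "insert n K" "f n"] K n by (simp add: ip_self norm_power t_def)
  moreover have "t - t\<^sup>2 \<le> 1 - t"
    using zero_le_power2[of "1 - t"] by (simp add: power2_eq_square algebra_simps)
  ultimately show ?thesis by (simp add: t_def)
qed

lemma norm_square_le_1: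
  assumes "n \<ge> 1"
  shows "(norm (f n))\<^sup>2 \<le> 1"
  using sum_norm_ip_frame_le[of "{}" n] assms by simp

text \<open>
  Take a nonzero \<open>u\<close> fixed by the frame sum over \<open>J \<union> {m}\<close> and put \<open>b = \<langle>u, f\<^sub>m\<rangle>\<close>. Then
  \<open>(I - S\<^sub>J) u = b f\<^sub>m\<close>, where \<open>b \<noteq> 0\<close> because \<open>I - S\<^sub>J\<close> is injective. Since this operator is
  self-adjoint, \<open>\<langle>u, f\<^sub>j\<rangle> = \<langle>u, (I - S\<^sub>J) h\<^sub>j\<rangle> = b \<langle>f\<^sub>m, h\<^sub>j\<rangle>\<close>. Inserting these coefficients into the inner
  product of \<open>u = b f\<^sub>m + S\<^sub>J u\<close> with \<open>f\<^sub>m\<close> and cancelling \<open>b\<close> gives the formula.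
\<close>
lemma one_minus_norm_square_eq:
  assumes J: "finite J" "J \<subseteq> {1..}" "complete_set smul (f ` ({1..} - J))"
    and m: "m \<ge> 1" "m \<notin> J" "\<not> complete_set smul (f ` ({1..} - insert m J))"
    and h: "\<And>j. j \<in> J \<Longrightarrow> h j - frame_sum J (h j) = f j"
  shows "of_real (1 - (norm (f m))\<^sup>2) = (\<Sum>j\<in>J. ip (f m) (h j) * ip (f j) (f m))"
proof -
  obtain u where u: "frame_sum (insert m J) u = u" "u \<noteq> 0"
    using complete_set_if_residual_injective[of "insert m J"] J m by auto
  define b where "b = ip u (f m)"
  have u_eq: "u = smul b (f m) + frame_sum J u"
    using u(1) J(1) m(2) by (simp add: frame_sum_def b_def)
  have b: "b \<noteq> 0"
  proof
    assume "b = 0"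
    then have "frame_sum J u = u"
      using u_eq by simp
    then show False
      using residual_injective_if_complete_set[OF J] u(2) by simp
  qed
  have coeff: "ip u (f j) = b * ip (f m) (h j)" if "j \<in> J" for j
  proof -
    have "ip u (f j) = ip (u - frame_sum J u) (h j)"
      using h[OF that, symmetric] by (simp add: ip_diff_left ip_diff_right frame_sum_self_adjoint)
    also have "u - frame_sum J u = smul b (f m)"
      using u_eq by (metis add_diff_cancel_right')
    finally show ?thesis by (simp add: ip_scale_left)
  qed
  have "b = b * ip (f m) (f m) + (\<Sum>j\<in>J. ip u (f j) * ip (f j) (f m))"
    using arg_cong[OF u_eq, of "\<lambda>x. ip x (f m)"]
    by (simp add: ip_add_left ip_scale_left ip_frame_sum_left flip: b_def)
  also have "\<dots> = b * (of_real ((norm (f m))\<^sup>2) + (\<Sum>j\<in>J. ip (f m) (h j) * ip (f j) (f m)))"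
    by (simp add: coeff ip_self sum_distrib_left distrib_left mult.assoc)
  finally have "1 = of_real ((norm (f m))\<^sup>2) + (\<Sum>j\<in>J. ip (f m) (h j) * ip (f j) (f m))"
    using b by simp
  then show ?thesis by (simp add: algebra_simps)
qed

text \<open>
  The bound \<open>B\<close> in the proof comes from \<open>p q \<le> (p\<^sup>2 + q\<^sup>2) / 2\<close>, applied to the terms of
  the formula for \<open>1 - \<parallel>f\<^sub>m\<parallel>\<^sup>2\<close>; it is summable as a finite sum of Parseval series. The formula covers
  all but the finitely many indices in \<open>J\<close>.
\<close>
lemma summable_one_minus_norm_square:
  assumes "excess smul f < \<infinity>"
  shows "summable (\<lambda>n. 1 - (norm (f (Suc n)))\<^sup>2)"
proof -
  obtain J where J: "finite J" "J \<subseteq> {1..}" "complete_set smul (f ` ({1..} - J))"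
    and max: "\<And>m. m \<ge> 1 \<Longrightarrow> m \<notin> J \<Longrightarrow> \<not> complete_set smul (f ` ({1..} - insert m J))"
    using maximal_removable_set[OF assms] by blast
  have "\<exists>h. h - frame_sum J h = f j" if "j \<in> J" for j
    using residual_surjective_on_span[OF J(1) residual_injective_if_complete_set[OF J]]
      span_base that by (metis imageI)
  then obtain h where h: "\<And>j. j \<in> J \<Longrightarrow> h j - frame_sum J (h j) = f j"
    by metis
  define B where "B m = (\<Sum>j\<in>J. ((norm (ip (h j) (f m)))\<^sup>2 + (norm (ip (f j) (f m)))\<^sup>2) / 2)" for m
  have summable: "summable (\<lambda>n. B (Suc n))"
    unfolding B_def using parseval
    by (intro summable_sum summable_divide summable_add) (auto simp: parseval_frame_def sums_iff)
  have bound: "norm (1 - (norm (f (Suc n)))\<^sup>2) \<le> B (Suc n)" if "Suc n \<notin> J" for n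
  proof -
    let ?m = "Suc n"
    have "norm (1 - (norm (f ?m))\<^sup>2) = norm (of_real (1 - (norm (f ?m))\<^sup>2) :: 'k)"
      by (simp only: norm_of_real real_norm_def)
    also have "\<dots> \<le> (\<Sum>j\<in>J. norm (ip (h j) (f ?m)) * norm (ip (f j) (f ?m)))"
      using norm_sum[of "\<lambda>j. ip (f ?m) (h j) * ip (f j) (f ?m)" J]
        one_minus_norm_square_eq[OF J _ that max[OF _ that] h]
      by (simp add: norm_mult norm_ip_commute[of "f ?m" "h _"] del: of_real_diff of_real_power)
    also have "\<dots> \<le> B ?m"
      unfolding B_def
    proof (rule sum_mono)
      fix j
      show "norm (ip (h j) (f ?m)) * norm (ip (f j) (f ?m))
          \<le> ((norm (ip (h j) (f ?m)))\<^sup>2 + (norm (ip (f j) (f ?m)))\<^sup>2) / 2"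
        using sum_squares_bound[of "norm (ip (h j) (f ?m))" "norm (ip (f j) (f ?m))"] by simp
    qed
    finally show ?thesis .
  qed
  have "\<forall>\<^sub>F n in sequentially. Suc n \<notin> J"
    using eventually_subset_atLeastAtMost[OF J(1,2)] by eventually_elim auto
  then have "\<forall>\<^sub>F n in sequentially. norm (1 - (norm (f (Suc n)))\<^sup>2) \<le> B (Suc n)"
    by eventually_elim (rule bound)
  then show ?thesis
    using summable by (rule summable_comparison_test_ev)
qed

section \<open>The defect of the partial frame operators\<close>
text \<open>
  As \<open>n \<notin> K\<close>, the expansion of the inner product involves only the coefficients \<open>\<langle>f\<^sub>n, f\<^sub>k\<rangle>\<close> with
  \<open>k \<noteq> n\<close>, whose squares add up to at most \<open>1 - \<parallel>f\<^sub>n\<parallel>\<^sup>2\<close>.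
\<close>
lemma norm_ip_frame_sum_le:
  assumes K: "finite K" "K \<subseteq> {1..}" and n: "n \<ge> 1" "n \<notin> K"
  shows "norm (ip (f n) (frame_sum K x)) \<le> sqrt (1 - (norm (f n))\<^sup>2) * norm x"
proof -
  have "ip (f n) (frame_sum K x) = (\<Sum>k\<in>K. ip (f n) (f k) * ip (f k) x)"
    by (simp add: ip_frame_sum_left flip: frame_sum_self_adjoint)
  then have "norm (ip (f n) (frame_sum K x))
      \<le> (\<Sum>k\<in>K. \<bar>norm (ip (f n) (f k))\<bar> * \<bar>norm (ip x (f k))\<bar>)"
    using norm_sum[of "\<lambda>k. ip (f n) (f k) * ip (f k) x" K]
    by (simp add: norm_mult norm_ip_commute[of _ x])
  also have "\<dots> \<le> sqrt (\<Sum>k\<in>K. (norm (ip (f n) (f k)))\<^sup>2) * sqrt (\<Sum>k\<in>K. (norm (ip x (f k)))\<^sup>2)"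
    by (rule sum_mult_le_sqrt_sum_squares)
  also have "\<dots> \<le> sqrt (1 - (norm (f n))\<^sup>2) * norm x"
    using sum_norm_ip_frame_le[OF assms] bessel[OF K, of x] norm_square_le_1[OF n(1)]
    by (intro mult_mono real_sqrt_le_mono real_le_lsqrt) (auto intro: sum_nonneg)
  finally show ?thesis .
qed

text \<open>
  With \<open>y = S x\<close> the left-hand side is \<open>\<langle>x - y, y\<rangle>\<close>. The vector \<open>x - y\<close> is the limit of the sums of
  \<open>\<langle>x, f\<^sub>k\<rangle> f\<^sub>k\<close> over \<open>n < k \<le> N\<close>, and every \<open>f\<^sub>k\<close> occurring there is almost orthogonal to \<open>y\<close> by the
  preceding estimate, so the Cauchy--Schwarz inequality bounds the inner product of each of these
  sums with \<open>y\<close>, uniformly in \<open>N\<close>.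
\<close>
lemma frame_sum_defect_le:
  assumes tail: "\<And>N. (\<Sum>k\<in>{n<..N}. 1 - (norm (f k))\<^sup>2) \<le> \<delta>\<^sup>2" and "\<delta> \<ge> 0"
  shows "(\<Sum>k=1..n. (norm (ip x (f k)))\<^sup>2) - (norm (frame_sum {1..n} x))\<^sup>2 \<le> \<delta> * (norm x)\<^sup>2"
    (is "?A - ?B \<le> _")
proof -
  define y where "y = frame_sum {1..n} x"
  have part: "norm (ip (frame_sum ({1..N} - {1..n}) x) y) \<le> \<delta> * (norm x)\<^sup>2" for N
  proof -
    have eq: "{1..N} - {1..n} = {n<..N}" by auto
    have "norm (ip (frame_sum {n<..N} x) y)
        \<le> (\<Sum>k\<in>{n<..N}. norm (ip x (f k)) * norm (ip (f k) y))"
      using norm_sum[of "\<lambda>k. ip x (f k) * ip (f k) y" "{n<..N}"]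
      by (simp add: ip_frame_sum_left norm_mult)
    also have "\<dots> \<le> (\<Sum>k\<in>{n<..N}. \<bar>norm (ip x (f k))\<bar> * \<bar>sqrt (1 - (norm (f k))\<^sup>2) * norm x\<bar>)"
    proof (intro sum_mono mult_mono)
      fix k assume "k \<in> {n<..N}"
      then show "norm (ip (f k) y) \<le> \<bar>sqrt (1 - (norm (f k))\<^sup>2) * norm x\<bar>"
        using norm_ip_frame_sum_le[of "{1..n}" k x] unfolding y_def by force
    qed auto
    also have "\<dots> \<le> sqrt (\<Sum>k\<in>{n<..N}. (norm (ip x (f k)))\<^sup>2)
        * sqrt (\<Sum>k\<in>{n<..N}. (sqrt (1 - (norm (f k))\<^sup>2) * norm x)\<^sup>2)"
      by (rule sum_mult_le_sqrt_sum_squares)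
    also have "(\<Sum>k\<in>{n<..N}. (sqrt (1 - (norm (f k))\<^sup>2) * norm x)\<^sup>2)
        = (\<Sum>k\<in>{n<..N}. 1 - (norm (f k))\<^sup>2) * (norm x)\<^sup>2"
      unfolding sum_distrib_right
      by (intro sum.cong refl) (use norm_square_le_1 in \<open>auto simp: power_mult_distrib\<close>)
    also have "sqrt (\<Sum>k\<in>{n<..N}. (norm (ip x (f k)))\<^sup>2)
          * sqrt ((\<Sum>k\<in>{n<..N}. 1 - (norm (f k))\<^sup>2) * (norm x)\<^sup>2)
        \<le> norm x * (\<delta> * norm x)"
    proof (intro mult_mono)
      show "sqrt (\<Sum>k\<in>{n<..N}. (norm (ip x (f k)))\<^sup>2) \<le> norm x"
        using bessel[of "{n<..N}" x] by (intro real_le_lsqrt) (auto simp: subset_iff intro: sum_nonneg)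
      have "(\<Sum>k\<in>{n<..N}. 1 - (norm (f k))\<^sup>2) * (norm x)\<^sup>2 \<le> (\<delta> * norm x)\<^sup>2"
        using tail[of N] by (simp add: power_mult_distrib mult_right_mono)
      then show "sqrt ((\<Sum>k\<in>{n<..N}. 1 - (norm (f k))\<^sup>2) * (norm x)\<^sup>2) \<le> \<delta> * norm x"
        using \<open>\<delta> \<ge> 0\<close> by (intro real_le_lsqrt) auto
      show "0 \<le> sqrt ((\<Sum>k\<in>{n<..N}. 1 - (norm (f k))\<^sup>2) * (norm x)\<^sup>2)"
        using norm_square_le_1 by (auto intro!: sum_nonneg mult_nonneg_nonneg)
    qed auto
    finally show ?thesis
      unfolding eq by (simp add: power2_eq_square mult_ac)
  qed
  have "(\<lambda>N. norm (ip (frame_sum ({1..N} - {1..n}) x) y)) \<longlonglongrightarrow> norm (ip (x - y) y)"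
    unfolding y_def by (intro tendsto_norm tendsto_ip_left frame_sum_Diff_tendsto) auto
  then have "norm (ip (x - y) y) \<le> \<delta> * (norm x)\<^sup>2"
    by (rule Lim_bounded) (use part in auto)
  moreover have "ip (x - y) y = of_real (?A - ?B)"
    using frame_sum_self_adjoint[of "{1..n}" x x] ip_frame_sum_self[of "{1..n}" x]
    by (simp add: ip_diff_left ip_self y_def)
  ultimately have "\<bar>?A - ?B\<bar> \<le> \<delta> * (norm x)\<^sup>2"
    by (simp only: norm_of_real)
  then show ?thesis by simp
qed

end

section \<open>Almost complementary head and tail\<close>
theorem theorem2p10:
  fixes smul :: "'k::real_or_complex \<Rightarrow> 'a::banach \<Rightarrow> 'a"
    and ip :: "'a \<Rightarrow> 'a \<Rightarrow> 'k"
    and f :: "nat \<Rightarrow> 'a"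
  assumes "hilbert_space smul ip"
    and "separable TYPE('a)"
    and "infinite_dimensional smul"
    and "parseval_frame ip f"
    and "excess smul f < \<infinity>"
  shows "\<forall>\<epsilon>::real. \<epsilon> > 0 \<longrightarrow> (\<exists>n0\<ge>1.
    (\<forall>x. x \<noteq> 0 \<longrightarrow>
      (\<Sum>n=1..n0. (norm (ip x (f n)))\<^sup>2)
        + (norm (\<Sum>n. smul (ip x (f (n + n0 + 1))) (f (n + n0 + 1))))\<^sup>2
      > (1 - \<epsilon>) * (norm x)\<^sup>2) \<and>
    (\<forall>x. x \<noteq> 0 \<longrightarrow>
      (\<Sum>n. (norm (ip x (f (n + n0 + 1))))\<^sup>2)
        + (norm (\<Sum>n=1..n0. smul (ip x (f n)) (f n)))\<^sup>2
      > (1 - \<epsilon>) * (norm x)\<^sup>2))"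
proof (intro allI impI)
  fix \<epsilon> :: real
  assume "\<epsilon> > 0"
  interpret hilbert_space smul ip by fact
  interpret parseval_hilbert_space smul ip f by unfold_locales fact
  have summable: "summable (\<lambda>n. 1 - (norm (f (Suc n)))\<^sup>2)"
    using assms(5) by (rule summable_one_minus_norm_square)
  \<comment> \<open>Half of \<open>\<epsilon>\<close> is given away to make the final inequality strict.\<close>
  have "(\<epsilon> / 2)\<^sup>2 > 0"
    using \<open>\<epsilon> > 0\<close> by simp
  then obtain M where M: "\<And>m n. m \<ge> M \<Longrightarrow> norm (\<Sum>k=m..<n. 1 - (norm (f (Suc k)))\<^sup>2) < (\<epsilon> / 2)\<^sup>2"
    using summable unfolding summable_Cauchy by metis
  define n0 where "n0 = Suc M"
  have tail: "(\<Sum>k\<in>{n0<..N}. 1 - (norm (f k))\<^sup>2) \<le> (\<epsilon> / 2)\<^sup>2" for N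
  proof -
    have "{n0<..N} = Suc ` {n0..<N}"
      by (auto simp: image_Suc_atLeastLessThan simp del: atLeastLessThanSuc)
    then have "(\<Sum>k\<in>{n0<..N}. 1 - (norm (f k))\<^sup>2) = (\<Sum>k=n0..<N. 1 - (norm (f (Suc k)))\<^sup>2)"
      by (simp only: sum.reindex inj_Suc comp_def)
    then show ?thesis
      using M[of n0 N] by (simp add: n0_def)
  qed
  have defect: "(\<Sum>k=1..n0. (norm (ip x (f k)))\<^sup>2) - (norm (frame_sum {1..n0} x))\<^sup>2 < \<epsilon> * (norm x)\<^sup>2"
    if "x \<noteq> 0" for x
  proof -
    have "\<epsilon> / 2 * (norm x)\<^sup>2 < \<epsilon> * (norm x)\<^sup>2"
      using \<open>\<epsilon> > 0\<close> that by (intro mult_strict_right_mono) auto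
    then show ?thesis
      using frame_sum_defect_le[OF tail, of x] \<open>\<epsilon> > 0\<close> by linarith
  qed
  have tail_sum: "(\<Sum>n. smul (ip x (f (n + n0 + 1))) (f (n + n0 + 1))) = x - frame_sum {1..n0} x" for x
  proof -
    have "(\<lambda>n. smul (ip x (f (Suc n))) (f (Suc n))) sums x"
      using frame_sum_tendsto[of x] by (simp add: sums_def frame_sum_def sum.atLeast1_atMost_eq)
    then have "(\<lambda>n. smul (ip x (f (Suc (n + n0)))) (f (Suc (n + n0)))) sums
        (x - (\<Sum>n<n0. smul (ip x (f (Suc n))) (f (Suc n))))"
      by (rule sums_split_initial_segment)
    then show ?thesis
      by (simp add: sums_iff frame_sum_def sum.atLeast1_atMost_eq)
  qed
  have tail_sum_squares: "(\<Sum>n. (norm (ip x (f (n + n0 + 1))))\<^sup>2)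
      = (norm x)\<^sup>2 - (\<Sum>k=1..n0. (norm (ip x (f k)))\<^sup>2)" for x
  proof -
    have "(\<lambda>n. (norm (ip x (f (Suc (n + n0)))))\<^sup>2) sums
        ((norm x)\<^sup>2 - (\<Sum>n<n0. (norm (ip x (f (Suc n))))\<^sup>2))"
      using parseval unfolding parseval_frame_def by (intro sums_split_initial_segment) blast
    then show ?thesis
      by (simp add: sums_iff sum.atLeast1_atMost_eq)
  qed
  show "\<exists>n0\<ge>1.
    (\<forall>x. x \<noteq> 0 \<longrightarrow>
      (\<Sum>n=1..n0. (norm (ip x (f n)))\<^sup>2)
        + (norm (\<Sum>n. smul (ip x (f (n + n0 + 1))) (f (n + n0 + 1))))\<^sup>2
      > (1 - \<epsilon>) * (norm x)\<^sup>2) \<and>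
    (\<forall>x. x \<noteq> 0 \<longrightarrow>
      (\<Sum>n. (norm (ip x (f (n + n0 + 1))))\<^sup>2)
        + (norm (\<Sum>n=1..n0. smul (ip x (f n)) (f n)))\<^sup>2
      > (1 - \<epsilon>) * (norm x)\<^sup>2)"
  proof (intro exI[of _ n0] conjI allI impI)
    show "1 \<le> n0" by (simp add: n0_def)
  next
    fix x :: 'a assume "x \<noteq> 0"
    then show "(\<Sum>n=1..n0. (norm (ip x (f n)))\<^sup>2)
        + (norm (\<Sum>n. smul (ip x (f (n + n0 + 1))) (f (n + n0 + 1))))\<^sup>2
      > (1 - \<epsilon>) * (norm x)\<^sup>2"
      unfolding tail_sum norm_diff_frame_sum using defect[of x] by (simp add: left_diff_distrib)
  next
    fix x :: 'a assume "x \<noteq> 0"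
    then show "(\<Sum>n. (norm (ip x (f (n + n0 + 1))))\<^sup>2)
        + (norm (\<Sum>n=1..n0. smul (ip x (f n)) (f n)))\<^sup>2
      > (1 - \<epsilon>) * (norm x)\<^sup>2"
      unfolding tail_sum_squares using defect[of x]
      by (simp add: left_diff_distrib frame_sum_def)
  qed
qed

end
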